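(* Let $\mathfrak g$ be a complex simple Lie algebra of rank $l$ with Cartan matrix $(a_{ij})$, let $\pi\in S_l$ and let $s_\pi=s_{\pi(1)}\cdots s_{\pi(l)}$ be the corresponding Coxeter element. Then for all $i,j=1,\ldots,l$ $$\left(\frac{1+s_\pi}{1-s_\pi}\alpha_i,\alpha_j\right)=\varepsilon^\pi_{ij}b_{ij},\qquad \varepsilon^\pi_{ij}=\begin{cases}-1,&\pi^{-1}(i)<\pi^{-1}(j),\\ 0,& i=j,\\ 1,&\pi^{-1}(i)>\pi^{-1}(j).\end{cases}$$
   Context: $d_1,\ldots,d_l$ are coprime positive integers such that the matrix $b_{ij}=d_ia_{ij}$ is symmetric; $\alpha_1,\ldots,\alpha_l$ are the simple roots (a basis of an $l$-dimensional complex vector space $\mathfrak h^*$); $(\cdot,\cdot)$ is the Weyl-group-invariant bilinear form on $\mathfrak h^*$ with $(\alpha_i,\alpha_j)=b_{ij}$; $s_i$ is the reflection in the simple root $\alpha_i$. The operator $1-s_\pi$ is invertible on $\mathfrak h^*$ and $\frac{1+s_\pi}{1-s_\pi}=(1+s_\pi)(1-s_\pi)^{-1}$. *)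

theory Defs
  imports
    Complex_Main
    "HOL-Library.Function_Algebras"
    "HOL-Combinatorics.Permutations"
begin

text \<open>The Lie algebra is the whole type \<open>'g\<close>, with explicit complex scalar multiplication and
  bracket.\<close>

locale complex_lie_algebra = vector_space scale
  for scale :: "complex \<Rightarrow> 'g::ab_group_add \<Rightarrow> 'g" +
  fixes br :: "'g \<Rightarrow> 'g \<Rightarrow> 'g"
  assumes finite_dimensional: "\<exists>B. finite B \<and> module.span scale B = UNIV"
    and br_add_left: "br (x + y) z = br x z + br y z"
    and br_add_right: "br x (y + z) = br x y + br x z"
    and br_scale_left: "br (scale c x) y = scale c (br x y)"
    and br_scale_right: "br x (scale c y) = scale c (br x y)"
    and br_self: "br x x = 0"
    and jacobi: "br x (br y z) + br y (br z x) + br z (br x y) = 0"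
begin

definition lie_subalgebra :: "'g set \<Rightarrow> bool" where
  "lie_subalgebra h \<longleftrightarrow> module.subspace scale h \<and> (\<forall>x\<in>h. \<forall>y\<in>h. br x y \<in> h)"

definition lie_ideal :: "'g set \<Rightarrow> bool" where
  "lie_ideal I \<longleftrightarrow> module.subspace scale I \<and> (\<forall>x. \<forall>y\<in>I. br x y \<in> I)"

definition br_span :: "'g set \<Rightarrow> 'g set \<Rightarrow> 'g set" where
  "br_span X Y = module.span scale {br x y |x y. x \<in> X \<and> y \<in> Y}"

primrec lower_central_series :: "'g set \<Rightarrow> nat \<Rightarrow> 'g set" where
  "lower_central_series h 0 = h"
| "lower_central_series h (Suc n) = br_span h (lower_central_series h n)"

definition nilpotent_subalgebra :: "'g set \<Rightarrow> bool" where
  "nilpotent_subalgebra h \<longleftrightarrow> lie_subalgebra h \<and> (\<exists>n. lower_central_series h n = {0})"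

definition normalizer :: "'g set \<Rightarrow> 'g set" where
  "normalizer h = {x. \<forall>y\<in>h. br x y \<in> h}"

definition cartan_subalgebra :: "'g set \<Rightarrow> bool" where
  "cartan_subalgebra h \<longleftrightarrow> nilpotent_subalgebra h \<and> normalizer h = h"

end

locale simple_complex_lie_algebra = complex_lie_algebra +
  assumes nonabelian: "\<exists>x y. br x y \<noteq> 0"
    and ideal_trivial: "lie_ideal I \<Longrightarrow> I = {0} \<or> I = UNIV"

text \<open>A linear functional on a subspace \<open>h\<close> is represented by a function on the whole type that is
  linear on \<open>h\<close> and, so that the representation is unique, zero off \<open>h\<close>. These functions form a
  complex vector space under the pointwise operations.\<close>

definition dual_scale :: "complex \<Rightarrow> ('g \<Rightarrow> complex) \<Rightarrow> 'g \<Rightarrow> complex" where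
  "dual_scale c f = (\<lambda>x. c * f x)"

definition dual_space ::
    "(complex \<Rightarrow> 'g::ab_group_add \<Rightarrow> 'g) \<Rightarrow> 'g set \<Rightarrow> ('g \<Rightarrow> complex) set" where
  "dual_space scale h = {f. (\<forall>x\<in>h. \<forall>y\<in>h. f (x + y) = f x + f y) \<and>
                            (\<forall>c. \<forall>x\<in>h. f (scale c x) = c * f x) \<and>
                            (\<forall>x. x \<notin> h \<longrightarrow> f x = 0)}"

context complex_lie_algebra
begin

definition root_space :: "'g set \<Rightarrow> ('g \<Rightarrow> complex) \<Rightarrow> 'g set" where
  "root_space h \<beta> = {x. \<forall>y\<in>h. br y x = scale (\<beta> y) x}"

definition roots :: "'g set \<Rightarrow> ('g \<Rightarrow> complex) set" where
  "roots h = {\<beta> \<in> dual_space scale h. \<beta> \<noteq> 0 \<and> root_space h \<beta> \<noteq> {0}}"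

definition simple_roots :: "'g set \<Rightarrow> nat \<Rightarrow> (nat \<Rightarrow> 'g \<Rightarrow> complex) \<Rightarrow> bool" where
  "simple_roots h l \<alpha> \<longleftrightarrow>
     \<alpha> ` {1..l} \<subseteq> roots h \<and> inj_on \<alpha> {1..l} \<and>
     \<not> module.dependent dual_scale (\<alpha> ` {1..l}) \<and>
     module.span dual_scale (\<alpha> ` {1..l}) = dual_space scale h \<and>
     (\<forall>\<beta>\<in>roots h. \<exists>n::nat \<Rightarrow> nat.
        \<beta> = (\<Sum>i\<in>{1..l}. dual_scale (of_nat (n i)) (\<alpha> i)) \<or>
        \<beta> = - (\<Sum>i\<in>{1..l}. dual_scale (of_nat (n i)) (\<alpha> i)))"

text \<open>The coroot of \<open>\<beta>\<close> is the unique element \<open>H\<close> of \<open>[g\<^sub>\<beta>, g\<^sub>-\<^sub>\<beta>] \<subseteq> h\<close> with \<open>\<beta>(H) = 2\<close>.\<close>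

definition is_coroot :: "'g set \<Rightarrow> ('g \<Rightarrow> complex) \<Rightarrow> 'g \<Rightarrow> bool" where
  "is_coroot h \<beta> H \<longleftrightarrow>
     H \<in> h \<and> H \<in> br_span (root_space h \<beta>) (root_space h (- \<beta>)) \<and> \<beta> H = 2"

text \<open>\<open>H i\<close> is the simple coroot of \<open>\<alpha> i\<close>, and the entry \<open>a\<^sub>i\<^sub>j\<close> is \<open>\<alpha>\<^sub>j(H\<^sub>i)\<close>, so that
  \<open>s\<^sub>i(\<alpha>\<^sub>j) = \<alpha>\<^sub>j - a\<^sub>i\<^sub>j \<alpha>\<^sub>i\<close>.\<close>

definition cartan_matrix ::
    "'g set \<Rightarrow> nat \<Rightarrow> (nat \<Rightarrow> 'g \<Rightarrow> complex) \<Rightarrow> (nat \<Rightarrow> 'g) \<Rightarrow> (nat \<Rightarrow> nat \<Rightarrow> int) \<Rightarrow> bool" where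
  "cartan_matrix h l \<alpha> H a \<longleftrightarrow>
     (\<forall>i\<in>{1..l}. is_coroot h (\<alpha> i) (H i) \<and> (\<forall>j\<in>{1..l}. of_int (a i j) = \<alpha> j (H i)))"

end

definition reflection ::
    "('g \<Rightarrow> complex) \<Rightarrow> 'g \<Rightarrow> ('g \<Rightarrow> complex) \<Rightarrow> 'g \<Rightarrow> complex" where
  "reflection \<beta> H f = f - dual_scale (f H) \<beta>"

text \<open>The simple reflections are involutions, so the monoid they generate is a group.\<close>

inductive_set weyl_group ::
    "nat \<Rightarrow> (nat \<Rightarrow> 'g \<Rightarrow> complex) \<Rightarrow> (nat \<Rightarrow> 'g) \<Rightarrow> (('g \<Rightarrow> complex) \<Rightarrow> 'g \<Rightarrow> complex) set"
  for l \<alpha> H where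
  one: "id \<in> weyl_group l \<alpha> H"
| mult: "i \<in> {1..l} \<Longrightarrow> w \<in> weyl_group l \<alpha> H \<Longrightarrow> reflection (\<alpha> i) (H i) \<circ> w \<in> weyl_group l \<alpha> H"

definition bilinear_form_on ::
    "('g \<Rightarrow> complex) set \<Rightarrow> (('g \<Rightarrow> complex) \<Rightarrow> ('g \<Rightarrow> complex) \<Rightarrow> complex) \<Rightarrow> bool" where
  "bilinear_form_on V B \<longleftrightarrow>
     (\<forall>x\<in>V. \<forall>y\<in>V. \<forall>z\<in>V. B (x + y) z = B x z + B y z \<and> B x (y + z) = B x y + B x z) \<and>
     (\<forall>c. \<forall>x\<in>V. \<forall>y\<in>V. B (dual_scale c x) y = c * B x y \<and> B x (dual_scale c y) = c * B x y)"

definition coxeter_element ::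
    "nat \<Rightarrow> (nat \<Rightarrow> 'g \<Rightarrow> complex) \<Rightarrow> (nat \<Rightarrow> 'g) \<Rightarrow> (nat \<Rightarrow> nat) \<Rightarrow> ('g \<Rightarrow> complex) \<Rightarrow> 'g \<Rightarrow> complex"
  where
  "coxeter_element l \<alpha> H \<pi> =
     foldr (\<lambda>k w. reflection (\<alpha> (\<pi> k)) (H (\<pi> k)) \<circ> w) [1..<Suc l] id"

text \<open>\<open>(1 + s)(1 - s)\<^sup>-\<^sup>1\<close>, where \<open>1 - s\<close> is inverted as an operator on \<open>V\<close>; this is meaningful when
  \<open>1 - s\<close> is bijective on \<open>V\<close>.\<close>

definition cayley_transform ::
    "('g \<Rightarrow> complex) set \<Rightarrow> (('g \<Rightarrow> complex) \<Rightarrow> 'g \<Rightarrow> complex) \<Rightarrow> ('g \<Rightarrow> complex) \<Rightarrow> 'g \<Rightarrow> complex"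
  where
  "cayley_transform V s = (\<lambda>y. y + s y) \<circ> inv_into V (\<lambda>y. y - s y)"

definition coxeter_sign :: "(nat \<Rightarrow> nat) \<Rightarrow> nat \<Rightarrow> nat \<Rightarrow> int" where
  "coxeter_sign \<pi> i j = (if i = j then 0 else if inv \<pi> i < inv \<pi> j then - 1 else 1)"

end

theory Submission
  imports Defs
begin

text \<open>
  Write \<open>s = s\<^sub>\<pi>\<close>, \<open>V\<close> for the dual of the Cartan subalgebra, and \<open>H\<^sub>j\<close> for the simple coroots.
  To apply \<open>(1 + s)(1 - s)\<^sup>-\<^sup>1\<close> to \<open>\<alpha>\<^sub>i\<close> it suffices to know the solution \<open>x\<close> of \<open>x - s x = \<alpha>\<^sub>i\<close>: the
  result is then \<open>x + s x = 2 x - \<alpha>\<^sub>i\<close>. A solution is easy to name through its values on the coroots.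
  Take \<open>x(H\<^sub>j) = 0\<close> for \<open>j\<close> after \<open>i\<close> in the order of the factors of \<open>s\<close>, \<open>x(H\<^sub>i) = 1\<close>, and
  \<open>x(H\<^sub>j) = \<alpha>\<^sub>i(H\<^sub>j)\<close> for \<open>j\<close> before \<open>i\<close>. Then the factors after \<open>s\<^sub>i\<close>, which act first, fix \<open>x\<close>;
  \<open>s\<^sub>i\<close> turns \<open>x\<close> into \<open>x - \<alpha>\<^sub>i\<close>; and this vector vanishes on the remaining coroots and so is fixed
  by the remaining factors (\<open>reflection_word_shift\<close>). Invariance of the form under \<open>s\<^sub>j\<close> gives
  \<open>(x, \<alpha>\<^sub>j) = d\<^sub>j x(H\<^sub>j)\<close> (\<open>invariant_form_root\<close>), hence
  \<open>(2 x - \<alpha>\<^sub>i, \<alpha>\<^sub>j) = 2 d\<^sub>j x(H\<^sub>j) - b\<^sub>i\<^sub>j\<close>, which is \<open>- b\<^sub>i\<^sub>j\<close>, \<open>0\<close> or \<open>b\<^sub>i\<^sub>j\<close> in the three cases.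

  What remains is that \<open>x\<close> exists and is unique. Both follow from the fact that the simple coroots
  form a basis of the Cartan subalgebra. For uniqueness: \<open>z - s z\<close> is a combination of the simple
  roots whose coefficients are a unitriangular transform of the values \<open>z(H\<^sub>k)\<close>, so \<open>s z = z\<close> forces
  all these values to vanish (\<open>reflection_word_fixed_vector\<close>).

  Independence of the coroots (\<open>coroots_independent\<close>) is a nondegeneracy property of the Cartan
  matrix, and it is here that the Lie algebra enters. The sum of all weight spaces of the Cartan
  subalgebra \<open>h\<close> carries the trace form \<open>tr (ad x ad y)\<close>. Its invariance makes \<open>tr (ad H\<^sub>i ad x)\<close>,
  as a functional of \<open>x\<close> in \<open>h\<close>, a multiple \<open>c\<^sub>i \<alpha>\<^sub>i(x)\<close> of the simple root, because \<open>H\<^sub>i\<close> lies in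
  the bracket of the root spaces of \<open>\<alpha>\<^sub>i\<close> and \<open>- \<alpha>\<^sub>i\<close>. The factor \<open>c\<^sub>i\<close> is not zero, because
  \<open>2 c\<^sub>i = tr (ad H\<^sub>i)\<^sup>2\<close> is the sum of the squares of the eigenvalues of \<open>ad H\<^sub>i\<close> on the weight
  spaces, which are integers and not all zero. A linear relation between the coroots thus becomes one between the simple roots.
\<close>

section \<open>Linear algebra\<close>

text \<open>For an independent \<open>B\<close>, the trace over \<open>span B\<close> of an operator that preserves this space. Working
  with a basis of a subspace avoids a separate type for the subspace.\<close>

definition trace_on ::
    "('a::field \<Rightarrow> 'b::ab_group_add \<Rightarrow> 'b) \<Rightarrow> 'b set \<Rightarrow> ('b \<Rightarrow> 'b) \<Rightarrow> 'a" where
  "trace_on scale B T = (\<Sum>b\<in>B. module.representation scale B (T b) b)"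

context vector_space
begin

lemma independent_imageI:
  assumes "finite I" and zero: "\<And>c. (\<Sum>i\<in>I. scale (c i) (f i)) = 0 \<Longrightarrow> \<forall>i\<in>I. c i = 0"
  shows "inj_on f I \<and> independent (f ` I)"
proof
  show inj: "inj_on f I"
  proof (rule inj_onI, rule ccontr)
    fix i j assume ij: "i \<in> I" "j \<in> I" "f i = f j" "i \<noteq> j"
    define c :: "'c \<Rightarrow> 'a" where "c = (\<lambda>k. (if k = i then 1 else 0) - (if k = j then 1 else 0))"
    have "(\<Sum>k\<in>I. scale (c k) (f k)) =
        (\<Sum>k\<in>I. if k = i then f k else 0) - (\<Sum>k\<in>I. if k = j then f k else 0)"
      unfolding sum_subtractf[symmetric]
      by (rule sum.cong) (auto simp: c_def scale_left_diff_distrib)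
    also have "\<dots> = 0" using ij \<open>finite I\<close> by simp
    finally show False using zero[of c] ij by (auto simp: c_def)
  qed
  show "independent (f ` I)"
  proof (rule independent_if_scalars_zero)
    fix u v assume u: "(\<Sum>v\<in>f ` I. scale (u v) v) = 0" and v: "v \<in> f ` I"
    then show "u v = 0" using zero[of "u \<circ> f"] by (auto simp: sum.reindex[OF inj])
  qed (use assms in simp)
qed

lemma independent_imageD:
  assumes "inj_on f I" "independent (f ` I)" "finite I" "(\<Sum>i\<in>I. scale (c i) (f i)) = 0" "i \<in> I"
  shows "c i = 0"
proof -
  have "(\<Sum>v\<in>f ` I. scale (c (inv_into I f v)) v) = 0"
    using assms(1,4) by (simp add: sum.reindex)
  from independentD[OF assms(2) _ order_refl this, of "f i"] show ?thesis
    using assms by simp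
qed

text \<open>The ambient space enters only through a finite spanning set, which guarantees that the basis
  behind \<open>dim S\<close> is finite.\<close>

lemma span_eq_subspace_if_card_eq_dim:
  assumes "finite T" "span T = UNIV" "subspace S" "A \<subseteq> S" "independent A" "card A = dim S"
  shows "span A = S"
proof
  show "span A \<subseteq> S" using assms by (intro span_minimal) auto
  show "S \<subseteq> span A"
  proof (rule ccontr)
    assume "\<not> S \<subseteq> span A"
    then obtain v where v: "v \<in> S" "v \<notin> span A" by auto
    obtain C where C: "C \<subseteq> S" "independent C" "S \<subseteq> span C" "card C = dim S" by (rule basis_exists)
    have "finite C" using independent_span_bound[OF assms(1) C(2)] assms(2) by simp
    moreover have "independent (insert v A)" using v assms(5) by (rule_tac independent_insertI)
    moreover have "insert v A \<subseteq> span C" using v assms(4) C by auto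
    ultimately have "finite (insert v A) \<and> card (insert v A) \<le> card C"
      by (rule independent_span_bound)
    moreover have "v \<notin> A" using v span_base by auto
    ultimately show False using C assms(6) by auto
  qed
qed

context
  fixes B assumes indep: "independent B"
begin

lemma trace_on_diff:
  assumes "S ` B \<subseteq> span B" "T ` B \<subseteq> span B"
  shows "trace_on scale B (\<lambda>v. S v - T v) = trace_on scale B S - trace_on scale B T"
  unfolding trace_on_def sum_subtractf[symmetric]
  using assms by (intro sum.cong) (auto simp: representation_diff[OF indep] image_subset_iff)

lemma trace_on_add:
  assumes "S ` B \<subseteq> span B" "T ` B \<subseteq> span B"
  shows "trace_on scale B (\<lambda>v. S v + T v) = trace_on scale B S + trace_on scale B T"
  unfolding trace_on_def sum.distrib[symmetric]
  using assms by (intro sum.cong) (auto simp: representation_add[OF indep] image_subset_iff)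

lemma trace_on_scale:
  assumes "S ` B \<subseteq> span B"
  shows "trace_on scale B (\<lambda>v. scale c (S v)) = c * trace_on scale B S"
  unfolding trace_on_def sum_distrib_left
  using assms by (intro sum.cong) (auto simp: representation_scale[OF indep] image_subset_iff)

lemma trace_on_diagonal:
  assumes "\<And>b. b \<in> B \<Longrightarrow> T b = scale (t b) b"
  shows "trace_on scale B T = sum t B"
  unfolding trace_on_def
  by (rule sum.cong) (auto simp: assms representation_scale[OF indep] representation_basis[OF indep] span_base)

lemma trace_on_commute:
  assumes "finite B" and P: "Vector_Spaces.linear scale scale P" "P ` span B \<subseteq> span B"
    and Q: "Vector_Spaces.linear scale scale Q" "Q ` span B \<subseteq> span B"
  shows "trace_on scale B (P \<circ> Q) = trace_on scale B (Q \<circ> P)"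
proof -
  let ?r = "representation B"
  have expand: "?r (F (G b)) b = (\<Sum>c\<in>B. ?r (G b) c * ?r (F c) b)"
    if F: "Vector_Spaces.linear scale scale F" "F ` span B \<subseteq> span B"
      and G: "G ` span B \<subseteq> span B" and "b \<in> B" for F G b
  proof -
    interpret F: Vector_Spaces.linear scale scale F by fact
    have "G b \<in> span B" using G \<open>b \<in> B\<close> span_base by blast
    then have "F (G b) = F (\<Sum>c\<in>B. scale (?r (G b) c) c)"
      using sum_representation_eq[OF indep _ \<open>finite B\<close>] by simp
    also have "\<dots> = (\<Sum>c\<in>B. scale (?r (G b) c) (F c))" by (simp add: F.sum F.scale)
    finally have FG: "F (G b) = (\<Sum>c\<in>B. scale (?r (G b) c) (F c))" .
    have Fc: "F c \<in> span B" if "c \<in> B" for c using F(2) that span_base by blast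
    show ?thesis
      unfolding FG by (subst representation_sum[OF indep])
        (auto intro!: span_scale sum.cong simp: representation_scale[OF indep] Fc)
  qed
  have "trace_on scale B (P \<circ> Q) = (\<Sum>b\<in>B. \<Sum>c\<in>B. ?r (Q b) c * ?r (P c) b)"
    unfolding trace_on_def by (intro sum.cong) (simp_all add: expand P Q)
  also have "\<dots> = (\<Sum>c\<in>B. \<Sum>b\<in>B. ?r (P c) b * ?r (Q b) c)"
    by (subst sum.swap) (simp add: mult.commute)
  also have "\<dots> = trace_on scale B (Q \<circ> P)"
    unfolding trace_on_def by (intro sum.cong) (simp_all add: expand P Q)
  finally show ?thesis .
qed

end

end

section \<open>Dual spaces\<close>

lemma vector_space_dual_scale: "vector_space (dual_scale :: complex \<Rightarrow> ('g \<Rightarrow> complex) \<Rightarrow> _)"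
  by unfold_locales (auto simp: dual_scale_def fun_eq_iff algebra_simps)

lemma sum_fun_apply: "(\<Sum>i\<in>I. f i) x = (\<Sum>i\<in>I. f i x)"
  by (induction I rule: infinite_finite_induct) auto

context complex_lie_algebra
begin

lemma dual_space_minus: "\<beta> \<in> dual_space scale h \<Longrightarrow> - \<beta> \<in> dual_space scale h"
  by (auto simp: dual_space_def)

lemma dual_space_add:
  "\<beta> \<in> dual_space scale h \<Longrightarrow> \<gamma> \<in> dual_space scale h \<Longrightarrow> \<beta> + \<gamma> \<in> dual_space scale h"
  by (auto simp: dual_space_def algebra_simps)

lemma dual_space_diff:
  "\<beta> \<in> dual_space scale h \<Longrightarrow> \<gamma> \<in> dual_space scale h \<Longrightarrow> \<beta> - \<gamma> \<in> dual_space scale h"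
  by (auto simp: dual_space_def algebra_simps)

lemma dual_space_scale:
  "\<beta> \<in> dual_space scale h \<Longrightarrow> dual_scale c \<beta> \<in> dual_space scale h"
  by (auto simp: dual_space_def dual_scale_def algebra_simps)

lemma dual_space_lincomb:
  assumes "\<beta> \<in> dual_space scale h" "subspace h" "\<And>i. i \<in> I \<Longrightarrow> v i \<in> h" "finite I"
  shows "\<beta> (\<Sum>i\<in>I. scale (c i) (v i)) = (\<Sum>i\<in>I. c i * \<beta> (v i))"
proof -
  have 0: "\<beta> 0 = 0"
    using assms(1) subspace_0[OF assms(2)] by (force simp: dual_space_def)
  show ?thesis using assms(4,3)
  proof (induction I)
    case (insert i I)
    then have "(\<Sum>i\<in>I. scale (c i) (v i)) \<in> h" "scale (c i) (v i) \<in> h"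
      using assms(2) by (auto intro!: subspace_sum subspace_scale)
    then show ?case using insert assms(1) by (simp add: dual_space_def)
  qed (simp add: 0)
qed

section \<open>Independence of the coroots\<close>

lemma linear_br: "Vector_Spaces.linear scale scale (br x)"
  by (simp add: Vector_Spaces.linear_iff br_add_right br_scale_right vector_space_axioms)

lemma br_skew: "br x y = - br y x"
proof -
  have "br (x + y) (x + y) = br x y + br y x"
    unfolding br_add_left br_add_right by (simp add: br_self)
  then show ?thesis by (simp add: br_self eq_neg_iff_add_eq_0)
qed

lemma br_zero_left [simp]: "br 0 y = 0"
  using br_add_left[of 0 0 y] by simp

lemma br_zero_right [simp]: "br x 0 = 0"
  using br_add_right[of x 0 0] by simp

lemma br_diff_right: "br x (y - z) = br x y - br x z"
  using br_add_right[of x "y - z" z] by simp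

lemma br_minus_right [simp]: "br x (- y) = - br x y"
  using br_scale_right[of x "-1" y] by simp

text \<open>The Jacobi identity in the form \<open>ad [x, y] = ad x ad y - ad y ad x\<close>.\<close>

lemma br_br_left: "br (br x y) z = br x (br y z) - br y (br x z)"
proof -
  have "br (br x y) z = - br z (br x y)" by (rule br_skew)
  also have "\<dots> = br x (br y z) + br y (br z x)"
    using jacobi[of x y z] by (metis add.commute minus_unique)
  also have "br z x = - br x z" by (rule br_skew)
  finally show ?thesis by simp
qed

text \<open>Weight \<open>0\<close> is included, so that the span of the weight vectors is stable under their brackets.\<close>

definition weight_vectors :: "'g set \<Rightarrow> 'g set" where
  "weight_vectors h = (\<Union>\<beta>\<in>dual_space scale h. root_space h \<beta>)"

lemma br_root_space:
  assumes "x \<in> root_space h \<beta>" "y \<in> root_space h \<gamma>"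
  shows "br x y \<in> root_space h (\<beta> + \<gamma>)"
  unfolding root_space_def
proof safe
  fix z assume z: "z \<in> h"
  have "br z (br x y) = br (br z x) y + br x (br z y)" by (simp add: br_br_left)
  also have "\<dots> = scale ((\<beta> + \<gamma>) z) (br x y)"
    using z assms by (simp add: root_space_def br_scale_left br_scale_right scale_left_distrib)
  finally show "br z (br x y) = scale ((\<beta> + \<gamma>) z) (br x y)" .
qed

lemma br_weight_vectors:
  "x \<in> weight_vectors h \<Longrightarrow> y \<in> weight_vectors h \<Longrightarrow> br x y \<in> weight_vectors h"
  unfolding weight_vectors_def UN_iff by (meson br_root_space dual_space_add)

end

text \<open>A basis \<open>W\<close> of the sum of all weight spaces, made of weight vectors \<open>b\<close> of weight \<open>wt b\<close>. The
  multiplicities of the weights are the numbers of basis vectors that share them. Their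
  sum is stable under \<open>h\<close> and the root vectors, so traces over it stand in for traces over the whole
  Lie algebra without a proof that \<open>h\<close> acts diagonalizably there.\<close>

locale weight_basis = complex_lie_algebra scale br
  for scale :: "complex \<Rightarrow> 'g::ab_group_add \<Rightarrow> 'g" and br +
  fixes h :: "'g set" and W :: "'g set" and wt :: "'g \<Rightarrow> 'g \<Rightarrow> complex"
  assumes finite_W: "finite W"
    and independent_W: "independent W"
    and wt_dual: "b \<in> W \<Longrightarrow> wt b \<in> dual_space scale h"
    and wt_space: "b \<in> W \<Longrightarrow> b \<in> root_space h (wt b)"
    and weight_vectors_subset: "weight_vectors h \<subseteq> span W"
begin

lemma br_cartan: "x \<in> h \<Longrightarrow> b \<in> W \<Longrightarrow> br x b = scale (wt b x) b"
  using wt_space by (auto simp: root_space_def)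

lemma br_preserves_spanI:
  assumes "\<And>b. b \<in> W \<Longrightarrow> br x b \<in> span W"
  shows "br x ` span W \<subseteq> span W"
proof -
  interpret X: Vector_Spaces.linear scale scale "br x" by (rule linear_br)
  have "br x ` W \<subseteq> span W" using assms by (simp add: image_subset_iff)
  then have "span (br x ` W) \<subseteq> span W" by (rule span_minimal) (rule subspace_span)
  then show ?thesis by (simp only: X.span_image)
qed

lemma br_cartan_span: "x \<in> h \<Longrightarrow> br x ` span W \<subseteq> span W"
  by (rule br_preserves_spanI) (simp add: br_cartan span_base span_scale)

lemma br_weight_vector_span:
  assumes "x \<in> weight_vectors h" shows "br x ` span W \<subseteq> span W"
proof (rule br_preserves_spanI)
  fix b assume "b \<in> W"
  then have "b \<in> weight_vectors h" unfolding weight_vectors_def UN_iff using wt_dual wt_space by meson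
  then show "br x b \<in> span W" using assms br_weight_vectors weight_vectors_subset by blast
qed

definition trace_form :: "'g \<Rightarrow> 'g \<Rightarrow> complex" where
  "trace_form x y = trace_on scale W (br x \<circ> br y)"

lemma trace_form_cartan:
  assumes "x \<in> h" "y \<in> h"
  shows "trace_form x y = (\<Sum>b\<in>W. wt b x * wt b y)"
  unfolding trace_form_def using assms
  by (intro trace_on_diagonal[OF independent_W]) (simp add: br_cartan br_scale_right mult.commute)

text \<open>Both sides differ from \<open>tr (e f x)\<close> by a trace, \<open>tr (f e x)\<close> and \<open>tr (e x f)\<close>, and these two agree
  by cyclicity.\<close>

lemma trace_form_br:
  assumes e: "br e ` span W \<subseteq> span W" and f: "br f ` span W \<subseteq> span W"
    and x: "br x ` span W \<subseteq> span W"
  shows "trace_form (br e f) x = trace_form e (br f x)"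
proof -
  have sp: "br e v \<in> span W" "br f v \<in> span W" "br x v \<in> span W" if "v \<in> span W" for v
    using that e f x by (simp_all add: image_subset_iff)
  note [simp] = sp span_base image_subset_iff
  let ?efx = "trace_on scale W (\<lambda>v. br e (br f (br x v)))" and ?exf = "trace_on scale W (\<lambda>v. br e (br x (br f v)))"
  have "trace_form (br e f) x = ?efx - trace_on scale W (\<lambda>v. br f (br e (br x v)))"
    unfolding trace_form_def comp_def br_br_left
    by (rule trace_on_diff[OF independent_W]) simp_all
  also have "trace_on scale W (\<lambda>v. br f (br e (br x v))) = ?exf"
  proof -
    have "trace_on scale W (br f \<circ> (br e \<circ> br x)) = trace_on scale W ((br e \<circ> br x) \<circ> br f)"
      by (rule trace_on_commute[OF independent_W finite_W])
        (simp_all add: linear_br Vector_Spaces.linear_compose[OF linear_br linear_br])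
    then show ?thesis by (simp add: comp_def)
  qed
  also have "?efx - ?exf = trace_form e (br f x)"
    unfolding trace_form_def comp_def br_br_left br_diff_right
    by (rule trace_on_diff[OF independent_W, symmetric]) simp_all
  finally show ?thesis .
qed

lemma trace_form_scale_right:
  assumes "br e ` span W \<subseteq> span W" "br f ` span W \<subseteq> span W"
  shows "trace_form e (scale c f) = c * trace_form e f"
  unfolding trace_form_def comp_def br_scale_left br_scale_right
  using assms by (intro trace_on_scale[OF independent_W]) (simp_all add: span_base image_subset_iff)

text \<open>For \<open>z = [e, f]\<close> invariance gives \<open>tr (ad z ad x) = tr (ad e ad [f, x])\<close>, and \<open>[f, x] = \<alpha>(x) f\<close>. The
  general case follows by linearity in \<open>z\<close>; the induction also has to carry along that \<open>ad z\<close>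
  preserves the span of \<open>W\<close>.\<close>

lemma trace_form_coroot_proportional:
  assumes \<alpha>: "\<alpha> \<in> dual_space scale h" and z: "z \<in> br_span (root_space h \<alpha>) (root_space h (- \<alpha>))"
  shows "\<exists>c. \<forall>x\<in>h. trace_form z x = c * \<alpha> x"
proof -
  have "br z ` span W \<subseteq> span W \<and> (\<exists>c. \<forall>x\<in>h. trace_form z x = c * \<alpha> x)"
    using z unfolding br_span_def
  proof (induction rule: span_induct_alt)
    case base
    have "trace_form 0 x = 0" for x
      using trace_on_diagonal[OF independent_W, of "br 0 \<circ> br x" "\<lambda>_. 0"]
      by (simp add: trace_form_def)
    then show ?case by (auto simp: span_zero intro!: exI[of _ 0])
  next
    case (step k u v)
    then obtain e f c where u: "u = br e f" and e: "e \<in> root_space h \<alpha>" and f: "f \<in> root_space h (- \<alpha>)"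
      and v: "br v ` span W \<subseteq> span W" and c: "\<forall>x\<in>h. trace_form v x = c * \<alpha> x"
      by auto
    have ef: "e \<in> weight_vectors h" "f \<in> weight_vectors h"
      using e f \<alpha> dual_space_minus by (auto simp: weight_vectors_def)
    note pe = br_weight_vector_span[OF ef(1)] and pf = br_weight_vector_span[OF ef(2)]
      and pu = br_weight_vector_span[OF br_weight_vectors[OF ef], folded u]
    have tu: "trace_form u x = trace_form e f * \<alpha> x" if x: "x \<in> h" for x
    proof -
      have "br x f = scale (- \<alpha> x) f" using f x by (simp add: root_space_def)
      then have "br f x = scale (\<alpha> x) f" using br_skew[of f x] by simp
      then show ?thesis
        using trace_form_br[OF pe pf br_cartan_span[OF x]] trace_form_scale_right[OF pe pf]
        by (simp add: u mult.commute)
    qed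
    have "trace_form (scale k u + v) x = (k * trace_form e f + c) * \<alpha> x" if x: "x \<in> h" for x
    proof -
      note px = br_cartan_span[OF x]
      have "trace_form (scale k u + v) x =
          trace_on scale W (\<lambda>w. scale k (br u (br x w))) + trace_on scale W (\<lambda>w. br v (br x w))"
        unfolding trace_form_def comp_def br_add_left br_scale_left
        using px pu v by (intro trace_on_add[OF independent_W]) (simp_all add: span_base span_scale image_subset_iff)
      also have "\<dots> = k * trace_form u x + trace_form v x"
        unfolding trace_form_def comp_def
        using px pu by (subst trace_on_scale[OF independent_W]) (simp_all add: span_base image_subset_iff)
      finally show ?thesis using tu[OF x] c x by (simp add: algebra_simps)
    qed
    moreover have "br (scale k u + v) ` span W \<subseteq> span W"
      using pu v by (auto simp: br_add_left br_scale_left image_subset_iff intro!: span_add span_scale)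
    ultimately show ?case by blast
  qed
  then show ?thesis by blast
qed

text \<open>At \<open>x = H\<close> the form is the sum of the squares of the real numbers \<open>wt b H\<close>. If it were zero, \<open>ad H\<close>
  would vanish on all weight vectors, but it acts by \<open>\<alpha>(H) = 2\<close> on the root space of \<open>\<alpha>\<close>.\<close>

lemma trace_form_coroot:
  assumes \<alpha>: "\<alpha> \<in> roots h" and H: "is_coroot h \<alpha> H" and real: "\<And>b. b \<in> W \<Longrightarrow> wt b H \<in> \<real>"
  shows "\<exists>c. c \<noteq> 0 \<and> (\<forall>x\<in>h. trace_form H x = c * \<alpha> x)"
proof -
  from H have Hh: "H \<in> h" and \<alpha>H: "\<alpha> H = 2" by (auto simp: is_coroot_def)
  obtain c where c: "\<forall>x\<in>h. trace_form H x = c * \<alpha> x"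
    using trace_form_coroot_proportional[of \<alpha> H] \<alpha> H by (auto simp: roots_def is_coroot_def)
  have \<alpha>d: "\<alpha> \<in> dual_space scale h" using \<alpha> by (simp add: roots_def)
  have "c \<noteq> 0"
  proof
    assume "c = 0"
    then have "(\<Sum>b\<in>W. wt b H * wt b H) = 0" using c Hh trace_form_cartan[OF Hh Hh] by simp
    moreover have "wt b H * wt b H = of_real ((Re (wt b H))\<^sup>2)" if "b \<in> W" for b
      using real[OF that] by (auto elim!: Reals_cases simp: power2_eq_square)
    ultimately have "of_real (\<Sum>b\<in>W. (Re (wt b H))\<^sup>2) = (0 :: complex)" by simp
    then have "(\<Sum>b\<in>W. (Re (wt b H))\<^sup>2) = 0" by (simp only: of_real_eq_0_iff)
    then have "\<forall>b\<in>W. Re (wt b H) = 0" using finite_W by (simp add: sum_nonneg_eq_0_iff)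
    then have wt0: "\<forall>b\<in>W. wt b H = 0" using real by (simp add: complex_is_Real_iff complex_eq_iff)
    have "0 \<in> root_space h \<alpha>" by (simp add: root_space_def)
    then obtain v where v: "v \<in> root_space h \<alpha>" "v \<noteq> 0" using \<alpha> by (auto simp: roots_def)
    interpret X: Vector_Spaces.linear scale scale "br H" by (rule linear_br)
    have "v \<in> span W" using v \<alpha>d weight_vectors_subset by (auto simp: weight_vectors_def)
    then have "br H v = 0" using X.eq_0_on_span[of W v] wt0 br_cartan[OF Hh] by simp
    moreover have "br H v = scale 2 v" using v(1) Hh \<alpha>H by (simp add: root_space_def)
    ultimately show False using v(2) by simp
  qed
  with c show ?thesis by blast
qed

end

context complex_lie_algebra
begin

lemma ex_weight_basis: "\<exists>W wt. weight_basis scale br h W wt"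
proof -
  obtain W where W: "W \<subseteq> weight_vectors h" "independent W" "weight_vectors h \<subseteq> span W"
    by (rule maximal_independent_subset)
  obtain T where "finite T" "span T = UNIV" using finite_dimensional by blast
  then have fin: "finite W" using independent_span_bound[of T W] W(2) by simp
  have "\<forall>b\<in>W. \<exists>\<beta>. \<beta> \<in> dual_space scale h \<and> b \<in> root_space h \<beta>"
    using W(1) by (auto simp: weight_vectors_def)
  then obtain wt where "\<forall>b\<in>W. wt b \<in> dual_space scale h \<and> b \<in> root_space h (wt b)"
    by metis
  then have "weight_basis scale br h W wt" using W fin by unfold_locales auto
  then show ?thesis by blast
qed

text \<open>Pairing a relation \<open>\<Sum> \<eta>\<^sub>i H\<^sub>i = 0\<close> with \<open>h\<close> under the trace form yields \<open>\<Sum> \<eta>\<^sub>i c\<^sub>i \<alpha>\<^sub>i = 0\<close> with nonzero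
  \<open>c\<^sub>i\<close>. Weights take real values on the coroots because each nonzero weight is a root, hence an
  integral combination of simple roots, and the Cartan matrix is integral.\<close>

lemma coroots_independent:
  assumes h: "subspace h" and simple: "simple_roots h l \<alpha>" and cm: "cartan_matrix h l \<alpha> H a"
  shows "inj_on H {1..l} \<and> independent (H ` {1..l})"
proof (rule independent_imageI)
  interpret D: vector_space "dual_scale :: complex \<Rightarrow> ('g \<Rightarrow> complex) \<Rightarrow> _"
    by (rule vector_space_dual_scale)
  obtain W wt where "weight_basis scale br h W wt" using ex_weight_basis by blast
  then interpret weight_basis scale br h W wt .
  have \<alpha>: "\<alpha> i \<in> roots h" "\<alpha> i \<in> dual_space scale h" if "i \<in> {1..l}" for i
    using simple that unfolding simple_roots_def roots_def by blast+
  have H: "is_coroot h (\<alpha> i) (H i)" "H i \<in> h"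
    and a: "j \<in> {1..l} \<Longrightarrow> \<alpha> j (H i) = of_int (a i j)" if "i \<in> {1..l}" for i j
    using cm that by (simp_all add: cartan_matrix_def is_coroot_def)
  have lincomb_real: "(\<Sum>i\<in>{1..l}. dual_scale (of_nat (n i)) (\<alpha> i)) (H j) \<in> \<real>"
    if "j \<in> {1..l}" for n :: "nat \<Rightarrow> nat" and j
  proof -
    have "(\<Sum>i\<in>{1..l}. dual_scale (of_nat (n i)) (\<alpha> i)) (H j) = (\<Sum>i\<in>{1..l}. of_nat (n i) * \<alpha> i (H j))"
      by (simp add: dual_scale_def sum_fun_apply)
    also have "\<dots> \<in> \<real>" using that by (intro sum_in_Reals) (auto simp: a)
    finally show ?thesis .
  qed
  have real: "wt b (H j) \<in> \<real>" if b: "b \<in> W" and j: "j \<in> {1..l}" for b j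
  proof (cases "wt b = 0")
    case False
    have "b \<noteq> 0" using b independent_W dependent_zero by blast
    then have "wt b \<in> roots h" using False wt_dual[OF b] wt_space[OF b] by (auto simp: roots_def)
    then obtain n :: "nat \<Rightarrow> nat" where
      "wt b = (\<Sum>i\<in>{1..l}. dual_scale (of_nat (n i)) (\<alpha> i)) \<or>
       wt b = - (\<Sum>i\<in>{1..l}. dual_scale (of_nat (n i)) (\<alpha> i))"
      using simple unfolding simple_roots_def by blast
    then show ?thesis using lincomb_real[OF j, of n] by auto
  qed simp
  have "\<forall>i\<in>{1..l}. \<exists>c. c \<noteq> 0 \<and> (\<forall>x\<in>h. trace_form (H i) x = c * \<alpha> i x)"
    using trace_form_coroot \<alpha> H real by blast
  then obtain c where c: "\<And>i. i \<in> {1..l} \<Longrightarrow> c i \<noteq> 0"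
    "\<And>i x. i \<in> {1..l} \<Longrightarrow> x \<in> h \<Longrightarrow> trace_form (H i) x = c i * \<alpha> i x" by metis
  fix \<eta> assume \<eta>: "(\<Sum>i\<in>{1..l}. scale (\<eta> i) (H i)) = 0"
  have "(\<Sum>i\<in>{1..l}. dual_scale (\<eta> i * c i) (\<alpha> i)) = 0"
  proof
    fix x
    have "(\<Sum>i\<in>{1..l}. \<eta> i * c i * \<alpha> i x) = 0"
    proof (cases "x \<in> h")
      case True
      have "(\<Sum>i\<in>{1..l}. \<eta> i * c i * \<alpha> i x) = (\<Sum>i\<in>{1..l}. \<eta> i * trace_form (H i) x)"
        using True by (simp add: c mult.assoc)
      also have "\<dots> = (\<Sum>i\<in>{1..l}. \<Sum>b\<in>W. \<eta> i * wt b (H i) * wt b x)"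
        using True H by (intro sum.cong) (auto simp: trace_form_cartan sum_distrib_left mult.assoc)
      also have "\<dots> = (\<Sum>b\<in>W. (\<Sum>i\<in>{1..l}. \<eta> i * wt b (H i)) * wt b x)"
        by (subst sum.swap) (simp add: sum_distrib_right)
      also have "\<dots> = (\<Sum>b\<in>W. wt b (\<Sum>i\<in>{1..l}. scale (\<eta> i) (H i)) * wt b x)"
        using H by (intro sum.cong refl) (subst dual_space_lincomb[OF wt_dual h], auto)
      also have "\<dots> = 0"
        unfolding \<eta> using dual_space_lincomb[OF wt_dual h, of _ "{}"] by simp
      finally show ?thesis .
    next
      case False
      then show ?thesis using \<alpha>(2) by (intro sum.neutral) (auto simp: dual_space_def)
    qed
    then show "(\<Sum>i\<in>{1..l}. dual_scale (\<eta> i * c i) (\<alpha> i)) x = 0 x"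
      by (simp add: dual_scale_def sum_fun_apply)
  qed
  moreover have "inj_on \<alpha> {1..l}" "D.independent (\<alpha> ` {1..l})"
    using simple unfolding simple_roots_def by blast+
  ultimately have "\<eta> i * c i = 0" if "i \<in> {1..l}" for i
    using D.independent_imageD[of \<alpha> "{1..l}" "\<lambda>i. \<eta> i * c i"] that by blast
  then show "\<forall>i\<in>{1..l}. \<eta> i = 0" using c(1) by auto
qed simp

lemma simple_root_in_dual_space:
  assumes "simple_roots h l \<alpha>" "i \<in> {1..l}"
  shows "\<alpha> i \<in> dual_space scale h"
  using assms unfolding simple_roots_def roots_def by blast

lemma coroots_span:
  assumes h: "subspace h" and "simple_roots h l \<alpha>" and cm: "cartan_matrix h l \<alpha> H a" and "dim h = l"
  shows "span (H ` {1..l}) = h"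
proof -
  obtain T where "finite T" "span T = UNIV" using finite_dimensional by blast
  moreover have "H ` {1..l} \<subseteq> h" using cm unfolding cartan_matrix_def is_coroot_def by blast
  moreover note indep = coroots_independent[OF assms(1-3)]
  moreover have "card (H ` {1..l}) = dim h"
    unfolding \<open>dim h = l\<close> card_image[OF conjunct1[OF indep]] by simp
  ultimately show ?thesis
    using span_eq_subspace_if_card_eq_dim[OF _ _ h, of T "H ` {1..l}"] by blast
qed

lemma dual_space_eq_0_if_zero_on_spanning:
  assumes h: "subspace h" "span (A :: 'g set) = h" and z: "z \<in> dual_space scale h" "\<forall>x\<in>A. z x = 0"
  shows "z = 0"
proof
  fix x
  show "z x = 0 x"
  proof (cases "x \<in> h")
    case True
    have "subspace {x \<in> h. z x = 0}"
    proof (rule subspaceI)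
      have "z 0 = 0" using dual_space_lincomb[OF z(1) h(1), of "{}"] by simp
      then show "0 \<in> {x \<in> h. z x = 0}" using h by (simp add: subspace_0)
    qed (use z(1) h(1) in \<open>simp_all add: dual_space_def subspace_add subspace_scale\<close>)
    moreover have "A \<subseteq> {x \<in> h. z x = 0}" using z(2) h(2) span_superset[of A] by blast
    ultimately have "span A \<subseteq> {x \<in> h. z x = 0}" by (rule_tac span_minimal)
    then show ?thesis using True h(2) by auto
  qed (use z(1) in \<open>simp add: dual_space_def\<close>)
qed

lemma ex_dual_space_interpolating:
  assumes h: "subspace h" and A: "inj_on H I" "independent (H ` I)" "H ` I \<subseteq> h"
  shows "\<exists>x\<in>dual_space scale h. \<forall>i\<in>I. x (H i) = t i"
proof -
  interpret P: vector_space_pair scale "(*) :: complex \<Rightarrow> complex \<Rightarrow> complex"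
    by unfold_locales (auto simp: algebra_simps)
  obtain g where g: "Vector_Spaces.linear scale (*) g" and gH: "\<forall>v\<in>H ` I. g v = t (inv_into I H v)"
    using P.linear_independent_extend[OF A(2), of "\<lambda>v. t (inv_into I H v)"] by blast
  interpret g: Vector_Spaces.linear scale "(*)" g by (rule g)
  define x where "x = (\<lambda>v. if v \<in> h then g v else 0)"
  have "x \<in> dual_space scale h"
    using h by (simp add: dual_space_def x_def g.add g.scale subspace_add subspace_scale)
  moreover have "\<forall>i\<in>I. x (H i) = t i" using A gH by (auto simp: x_def)
  ultimately show ?thesis by blast
qed

end

section \<open>Products of reflections\<close>

text \<open>Coxeter elements are words in the simple reflections in the order given by \<open>\<pi>\<close>. An arbitrary index
  list makes induction and splitting of the word possible.\<close>

definition reflection_word ::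
    "('i \<Rightarrow> 'g \<Rightarrow> complex) \<Rightarrow> ('i \<Rightarrow> 'g) \<Rightarrow> 'i list \<Rightarrow> ('g \<Rightarrow> complex) \<Rightarrow> 'g \<Rightarrow> complex" where
  "reflection_word \<beta> H ks = foldr (\<lambda>k w. reflection (\<beta> k) (H k) \<circ> w) ks id"

lemma reflection_word_Nil [simp]: "reflection_word \<beta> H [] x = x"
  and reflection_word_Cons [simp]:
    "reflection_word \<beta> H (k # ks) x = reflection (\<beta> k) (H k) (reflection_word \<beta> H ks x)"
  by (simp_all add: reflection_word_def)

lemma reflection_word_append:
  "reflection_word \<beta> H (ks @ ls) x = reflection_word \<beta> H ks (reflection_word \<beta> H ls x)"
  by (induction ks) auto

lemma reflection_diff: "reflection \<beta> H (x - y) = reflection \<beta> H x - reflection \<beta> H y"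
  by (simp add: reflection_def dual_scale_def fun_eq_iff algebra_simps)

lemma reflection_word_diff:
  "reflection_word \<beta> H ks (x - y) = reflection_word \<beta> H ks x - reflection_word \<beta> H ks y"
  by (induction ks) (simp_all only: reflection_word_Nil reflection_word_Cons reflection_diff)

lemma reflection_word_fixes:
  "\<forall>k\<in>set ks. x (H k) = 0 \<Longrightarrow> reflection_word \<beta> H ks x = x"
  by (induction ks) (auto simp: reflection_def dual_scale_def fun_eq_iff)

lemma coxeter_element_eq_word: "coxeter_element l \<alpha> H \<pi> = reflection_word (\<alpha> \<circ> \<pi>) (H \<circ> \<pi>) [1..<Suc l]"
  by (simp add: coxeter_element_def reflection_word_def)

text \<open>The coefficient \<open>c k\<close> is the value at \<open>H k\<close> of the vector that the reflection with index \<open>k\<close> acts on.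
  When all coefficients vanish, every such vector is \<open>z\<close> itself.\<close>

lemma reflection_word_expand:
  assumes "distinct ks"
  shows "\<exists>c. reflection_word \<beta> H ks z = z - (\<Sum>k\<in>set ks. dual_scale (c k) (\<beta> k)) \<and>
    ((\<forall>k\<in>set ks. c k = 0) \<longrightarrow> (\<forall>k\<in>set ks. z (H k) = 0))"
  using assms
proof (induction ks)
  case (Cons k ks)
  then have "distinct ks" by simp
  from Cons.IH[OF this] obtain c where c: "reflection_word \<beta> H ks z = z - (\<Sum>k\<in>set ks. dual_scale (c k) (\<beta> k))"
    "(\<forall>k\<in>set ks. c k = 0) \<longrightarrow> (\<forall>k\<in>set ks. z (H k) = 0)" by blast
  define c' where "c' = c(k := reflection_word \<beta> H ks z (H k))"
  have "k \<notin> set ks" using Cons by simp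
  then have same: "(\<Sum>m\<in>set ks. dual_scale (c' m) (\<beta> m)) = (\<Sum>m\<in>set ks. dual_scale (c m) (\<beta> m))"
    by (intro sum.cong) (auto simp: c'_def)
  have "reflection_word \<beta> H (k # ks) z = z - (\<Sum>m\<in>set (k # ks). dual_scale (c' m) (\<beta> m))"
    using \<open>k \<notin> set ks\<close> by (simp add: reflection_def same) (simp add: c c'_def algebra_simps)
  moreover have "\<forall>m\<in>set (k # ks). z (H m) = 0" if "\<forall>m\<in>set (k # ks). c' m = 0"
  proof -
    have 0: "\<forall>m\<in>set ks. c m = 0"
      using that \<open>k \<notin> set ks\<close> unfolding c'_def by (metis fun_upd_other list.set_intros(2))
    then have "reflection_word \<beta> H ks z = z"
      unfolding c(1) by (simp add: dual_scale_def fun_eq_iff sum_fun_apply)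
    with that 0 c(2) show ?thesis by (auto simp: c'_def)
  qed
  ultimately show ?case by blast
qed auto

lemma reflection_word_fixed_vector:
  assumes indep: "inj_on \<beta> (set ks)" "\<not> module.dependent dual_scale (\<beta> ` set ks)"
    and "distinct ks" and fixed: "reflection_word \<beta> H ks z = z" and "k \<in> set ks"
  shows "z (H k) = 0"
proof -
  interpret D: vector_space "dual_scale :: complex \<Rightarrow> ('b \<Rightarrow> complex) \<Rightarrow> _"
    by (rule vector_space_dual_scale)
  obtain c where c: "reflection_word \<beta> H ks z = z - (\<Sum>k\<in>set ks. dual_scale (c k) (\<beta> k))"
    "(\<forall>k\<in>set ks. c k = 0) \<longrightarrow> (\<forall>k\<in>set ks. z (H k) = 0)"
    using reflection_word_expand[OF \<open>distinct ks\<close>] by blast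
  have "(\<Sum>k\<in>set ks. dual_scale (c k) (\<beta> k)) = 0" using c(1) fixed by simp
  then have "\<forall>k\<in>set ks. c k = 0" using D.independent_imageD[OF indep] by simp
  then show ?thesis using c(2) \<open>k \<in> set ks\<close> by blast
qed

text \<open>The letters \<open>ls\<close> act first and fix \<open>x\<close>, the letter \<open>p\<close> subtracts \<open>\<beta> p\<close>, and the letters \<open>ks\<close> fix the
  difference.\<close>

lemma reflection_word_shift:
  assumes "x (H p) = 1" "\<forall>q\<in>set ks. x (H q) = \<beta> p (H q)" "\<forall>q\<in>set ls. x (H q) = 0"
  shows "reflection_word \<beta> H (ks @ p # ls) x = x - \<beta> p"
proof -
  have "reflection_word \<beta> H (p # ls) x = x - \<beta> p"
    using assms by (simp add: reflection_word_fixes reflection_def dual_scale_def)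
  then show ?thesis
    unfolding reflection_word_append using assms by (simp add: reflection_word_fixes)
qed

text \<open>The reflection maps \<open>\<beta>\<close> to \<open>- \<beta>\<close> and \<open>x\<close> to \<open>x - x(H) \<beta>\<close>; expanding the invariance of \<open>B x \<beta>\<close> gives the
  claim.\<close>

lemma invariant_form_root:
  assumes B: "bilinear_form_on V B" and V: "x \<in> V" "\<beta> \<in> V" "\<And>c. dual_scale c \<beta> \<in> V"
    and inv: "B (reflection \<beta> H x) (reflection \<beta> H \<beta>) = B x \<beta>" and "\<beta> H = 2"
  shows "2 * B x \<beta> = x H * B \<beta> \<beta>"
proof -
  have "reflection \<beta> H \<beta> = dual_scale (-1) \<beta>"
    using \<open>\<beta> H = 2\<close> by (simp add: reflection_def dual_scale_def fun_eq_iff)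
  moreover have "reflection \<beta> H x = x + dual_scale (- x H) \<beta>"
    by (simp add: reflection_def dual_scale_def fun_eq_iff)
  ultimately have "B x \<beta> = B (x + dual_scale (- x H) \<beta>) (dual_scale (-1) \<beta>)" using inv by simp
  also have "\<dots> = - (B x \<beta> + B (dual_scale (- x H) \<beta>) \<beta>)"
    using B V by (simp add: bilinear_form_on_def)
  also have "B (dual_scale (- x H) \<beta>) \<beta> = - x H * B \<beta> \<beta>"
    using B V unfolding bilinear_form_on_def by blast
  finally show ?thesis by (simp add: algebra_simps)
qed

section \<open>The Cayley transform of a Coxeter element\<close>

theorem lemma3:
  fixes scale :: "complex \<Rightarrow> 'g::ab_group_add \<Rightarrow> 'g"
    and br :: "'g \<Rightarrow> 'g \<Rightarrow> 'g"
    and h :: "'g set"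
    and l :: nat
    and \<alpha> :: "nat \<Rightarrow> 'g \<Rightarrow> complex"
    and H :: "nat \<Rightarrow> 'g"
    and a :: "nat \<Rightarrow> nat \<Rightarrow> int"
    and d :: "nat \<Rightarrow> nat"
    and b :: "nat \<Rightarrow> nat \<Rightarrow> int"
    and B :: "('g \<Rightarrow> complex) \<Rightarrow> ('g \<Rightarrow> complex) \<Rightarrow> complex"
    and \<pi> :: "nat \<Rightarrow> nat"
  assumes "simple_complex_lie_algebra scale br"
    and "complex_lie_algebra.cartan_subalgebra scale br h"
    and "vector_space.dim scale h = l"
    and "complex_lie_algebra.simple_roots scale br h l \<alpha>"
    and "complex_lie_algebra.cartan_matrix scale br h l \<alpha> H a"
    and "\<forall>i\<in>{1..l}. d i > 0"
    and "Gcd (d ` {1..l}) = 1"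
    and "\<forall>i\<in>{1..l}. \<forall>j\<in>{1..l}. b i j = int (d i) * a i j"
    and "\<forall>i\<in>{1..l}. \<forall>j\<in>{1..l}. b i j = b j i"
    and "bilinear_form_on (dual_space scale h) B"
    and "\<forall>w\<in>weyl_group l \<alpha> H. \<forall>x\<in>dual_space scale h. \<forall>y\<in>dual_space scale h. B (w x) (w y) = B x y"
    and "\<forall>i\<in>{1..l}. \<forall>j\<in>{1..l}. B (\<alpha> i) (\<alpha> j) = of_int (b i j)"
    and "\<pi> permutes {1..l}"
  shows "\<forall>i\<in>{1..l}. \<forall>j\<in>{1..l}.
           B (cayley_transform (dual_space scale h) (coxeter_element l \<alpha> H \<pi>) (\<alpha> i)) (\<alpha> j)
             = of_int (coxeter_sign \<pi> i j * b i j)"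
proof (intro ballI)
  interpret simple_complex_lie_algebra scale br by fact
  let ?V = "dual_space scale h" and ?s = "coxeter_element l \<alpha> H \<pi>"
  note simple = assms(4) and cm = assms(5) and form = assms(10) and perm = assms(13)
  have h: "subspace h"
    using assms(2) by (simp add: cartan_subalgebra_def nilpotent_subalgebra_def lie_subalgebra_def)
  have \<alpha>: "\<alpha> k \<in> ?V" if "k \<in> {1..l}" for k using simple_root_in_dual_space[OF simple that] .
  have H: "H k \<in> h" "\<alpha> k (H k) = 2" and a: "m \<in> {1..l} \<Longrightarrow> \<alpha> m (H k) = of_int (a k m)"
    if "k \<in> {1..l}" for k m
    using cm that by (simp_all add: cartan_matrix_def is_coroot_def)
  note indepH = coroots_independent[OF h simple cm]
  note spanH = coroots_span[OF h simple cm \<open>dim h = l\<close>]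
  have image: "\<pi> ` {1..l} = {1..l}" using perm by (rule permutes_image)
  have Vdiff: "x - y \<in> ?V" if "x \<in> ?V" "y \<in> ?V" for x y
    using that by (rule dual_space_diff)

  have "inj_on \<alpha> {1..l}" and "\<not> module.dependent dual_scale (\<alpha> ` {1..l})"
    using simple unfolding simple_roots_def by blast+
  then have inj_\<alpha>\<pi>: "inj_on (\<alpha> \<circ> \<pi>) {1..l}"
    and indep_\<alpha>\<pi>: "\<not> module.dependent dual_scale ((\<alpha> \<circ> \<pi>) ` {1..l})"
    using permutes_inj_on[OF perm, of "{1..l}"]
    by (simp_all only: image comp_inj_on image_comp[symmetric] not_False_eq_True)

  (* Since 1 - s is injective on the dual space, any preimage of \<alpha>\<^sub>i is the one that the
     inverse in the Cayley transform picks. *)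
  have inj: "inj_on (\<lambda>y. y - ?s y) ?V"
  proof (rule inj_onI)
    fix x y assume xy: "x \<in> ?V" "y \<in> ?V" "x - ?s x = y - ?s y"
    have "x - y = (x - ?s x) - (y - ?s y) + (?s x - ?s y)" by (simp only: fun_eq_iff) simp
    also have "\<dots> = ?s x - ?s y" using xy(3) by (simp only: diff_self add_0)
    also have "\<dots> = ?s (x - y)" unfolding coxeter_element_eq_word by (rule reflection_word_diff[symmetric])
    finally have "?s (x - y) = x - y" by (rule sym)
    then have "(x - y) ((H \<circ> \<pi>) k) = 0" if "k \<in> {1..l}" for k
      using reflection_word_fixed_vector[of "\<alpha> \<circ> \<pi>" "[1..<Suc l]" "H \<circ> \<pi>" "x - y" k]
        inj_\<alpha>\<pi> indep_\<alpha>\<pi> that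
      unfolding coxeter_element_eq_word set_upt atLeastLessThanSuc_atLeastAtMost
      by (simp only: distinct_upt simp_thms)
    then have "\<forall>v\<in>H ` {1..l}. (x - y) v = 0"
      using image by (metis (no_types, lifting) comp_apply image_iff)
    then have "x - y = 0"
      using dual_space_eq_0_if_zero_on_spanning[OF h spanH Vdiff[OF xy(1,2)]] by blast
    then show "x = y" by simp
  qed

  fix i j assume i: "i \<in> {1..l}" and j: "j \<in> {1..l}"
  let ?p = "inv \<pi>"
  (* Reading s(x) from the right, the reflections after position ?p i must fix x, the one at ?p i
     must subtract \<alpha>\<^sub>i, and the ones before it must fix x - \<alpha>\<^sub>i. This dictates the values
     of x on the coroots. *)
  define t :: "nat \<Rightarrow> complex" where
    "t m = (if ?p m < ?p i then \<alpha> i (H m) else if m = i then 1 else 0)" for m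
  have "H ` {1..l} \<subseteq> h" using H(1) by blast
  then obtain x where x: "x \<in> ?V" and xH: "\<forall>m\<in>{1..l}. x (H m) = t m"
    using ex_dual_space_interpolating[OF h, of H "{1..l}" t] indepH by blast
  have p_in: "?p i \<in> {1..l}" using permutes_in_image[OF permutes_inv[OF perm]] i by blast
  have \<pi>p: "\<pi> (?p i) = i" and p\<pi>: "?p (\<pi> q) = q" for q
    using permutes_inverses[OF perm] by auto
  have sx: "?s x = x - \<alpha> i"
  proof -
    have split: "[1..<Suc l] = [1..<?p i] @ ?p i # [Suc (?p i)..<Suc l]"
      using p_in upt_add_eq_append[of 1 "?p i" "Suc l - ?p i"] upt_conv_Cons[of "?p i" "Suc l"]
      by (simp del: upt_Suc)
    have x\<pi>: "x (H (\<pi> q)) = (if q < ?p i then \<alpha> i (H (\<pi> q)) else if q = ?p i then 1 else 0)"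
      if "q \<in> {1..l}" for q
    proof -
      have "\<pi> q \<in> {1..l}" using that image by blast
      moreover have "\<pi> q = i \<longleftrightarrow> q = ?p i" using p\<pi>[of q] \<pi>p by metis
      ultimately show ?thesis using xH p\<pi>[of q] by (simp add: t_def)
    qed
    have "?s x = x - (\<alpha> \<circ> \<pi>) (?p i)"
      unfolding coxeter_element_eq_word split
      using p_in x\<pi>[OF p_in] by (intro reflection_word_shift) (auto simp: x\<pi> \<pi>p simp del: upt_Suc)
    then show ?thesis by (simp add: \<pi>p)
  qed
  have "inv_into ?V (\<lambda>y. y - ?s y) (\<alpha> i) = x"
    by (rule inv_into_f_eq[OF inj x]) (simp add: sx)
  then have cayley: "cayley_transform ?V ?s (\<alpha> i) = x + (x - \<alpha> i)"
    by (simp add: cayley_transform_def sx)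

  have add: "B (u + v) w = B u w + B v w" if "u \<in> ?V" "v \<in> ?V" "w \<in> ?V" for u v w
    using form that unfolding bilinear_form_on_def by blast
  have "B (x - \<alpha> i) (\<alpha> j) = B x (\<alpha> j) - B (\<alpha> i) (\<alpha> j)"
    using add[OF Vdiff[OF x \<alpha>[OF i]] \<alpha>[OF i] \<alpha>[OF j]] by simp
  then have "B (cayley_transform ?V ?s (\<alpha> i)) (\<alpha> j) = 2 * B x (\<alpha> j) - of_int (b i j)"
    unfolding cayley using add[OF x Vdiff[OF x \<alpha>[OF i]] \<alpha>[OF j]] assms(12) i j by simp
  also have "2 * B x (\<alpha> j) = 2 * of_nat (d j) * t j"
  proof -
    have "reflection (\<alpha> j) (H j) \<in> weyl_group l \<alpha> H"
      using weyl_group.mult[OF j weyl_group.one] by simp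
    then have "2 * B x (\<alpha> j) = x (H j) * B (\<alpha> j) (\<alpha> j)"
      using assms(11) x \<alpha>[OF j] H(2)[OF j] dual_space_scale
      by (intro invariant_form_root[OF form]) auto
    moreover have "B (\<alpha> j) (\<alpha> j) = 2 * of_nat (d j)"
    proof -
      have "complex_of_int (a j j) = 2" using a[OF j j] H(2)[OF j] by simp
      then show ?thesis using assms(8,12) j by simp
    qed
    ultimately show ?thesis using xH j by simp
  qed
  also have "2 * of_nat (d j) * t j - of_int (b i j) = of_int (coxeter_sign \<pi> i j * b i j)"
  proof -
    have "of_nat (d j) * \<alpha> i (H j) = complex_of_int (b i j)"
      using a[OF j i] assms(8,9) i j by (metis of_int_mult of_int_of_nat_eq)
    moreover have "?p i = ?p j \<longleftrightarrow> i = j"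
      using permutes_inj[OF permutes_inv[OF perm]] by (simp add: inj_eq)
    ultimately show ?thesis
      using H(2)[OF i] by (auto simp: t_def coxeter_sign_def mult.commute)
  qed
  finally show "B (cayley_transform ?V ?s (\<alpha> i)) (\<alpha> j) = of_int (coxeter_sign \<pi> i j * b i j)" .
qed

end
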